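(* Let $A_1=(x_1,y_1)$, $A_2=(x_2,y_2)$, $B_1=(u_1,v_1)$, $B_2=(u_2,v_2)$ be points in $\mathbb Z^2$ with $A_1\prec A_2$ and $B_1\prec B_2$. Suppose additionally that $x_1+y_1=x_2+y_2$. Then, for all $m\ge0$, $$H^{\ge 2m+1}_{A_1\to B_2,A_2\to B_1}(q)=H^{\ge 2m}_{A_1\to B_2,A_2\to B_1}(q)=f_{2m,A_1,A_2,B_2,B_1}(q),$$ and for all $m\ge1$, $$H^{\ge 2m}_{A_1\to B_1,A_2\to B_2}(q)=H^{\ge 2m-1}_{A_1\to B_1,A_2\to B_2}(q)=f_{2m-1,A_1,A_2,B_2,B_1}(q).$$ Let now $A=(x,y)$ and $B=(u,v)$ be points in $\mathbb Z^2$. Then, for all $r\ge0$, $$H^{\ge r}_{A\to B_1,A\to B_2}(q)=f_{r,A,A,B_2,B_1}(q),$$ $$H^{\ge r}_{A_1\to B,A_2\to B}(q)=f_{r,A_1,A_2,B,B}(q),$$ $$H^{\ge r}_{A\to B,A\to B}(q)=\begin{cases} f_{0,A,A,B,B}(q) & \text{if } r=0,\\[1mm] 2\sum_{j\ge1}(-1)^{j-1}f_{r+j,A,A,B,B}(q) & \text{if } r\ge1.\end{cases}$$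
   Context: Paths are lattice paths in $\mathbb Z^2$ with steps $N=(0,1)$ and $E=(1,0)$; $\mathcal P_{A\to B}$ is the set of such paths from $A$ to $B$. A valley of a path is a vertex preceded by an $E$ and followed by an $N$; $\operatorname{maj}(P)$ is the sum of the positions of the valleys of $P$, where the vertices of $P$ are numbered $0,1,2,\dots$ along the path, the starting point being at position $0$. For points $A_1=(x_1,y_1)$, $A_2=(x_2,y_2)$, write $A_1\prec A_2$ if $x_1<x_2$ and $y_1>y_2$. A crossing of two paths $P$ and $Q$ is a common vertex $C$ such that: (i) $P$ and $Q$ disagree in the step arriving at $C$ (one arrives with an $N$, the other with an $E$), and they disagree again in some step after $C$ (comparing, for each $i\ge1$, the $i$th step of $P$ after $C$ with the $i$th step of $Q$ after $C$); (ii) at the first step after $C$ where $P$ and $Q$ disagree again, each path has the same type of step ($N$ or $E$) as it had when arriving at $C$. Let $\chi(P,Q)$ be the number of crossings of $P$ and $Q$. For points $A,A',B,B'\in\mathbb Z^2$ and $r\ge0$, $$\mathcal P^{\ge r}_{A\to B,A'\to B'}=\{(P,Q):P\in\mathcal P_{A\to B},\ Q\in\mathcal P_{A'\to B'},\ \chi(P,Q)\ge r\},$$ $$H^{\ge r}_{A\to B,A'\to B'}(q)=\sum_{(P,Q)\in\mathcal P^{\ge r}_{A\to B,A'\to B'}}q^{\operatorname{maj}(P)+\operatorname{maj}(Q)}.$$ For integers $n,k$, the $q$-binomial coefficient is $$\begin{bmatrix}n\\k\end{bmatrix}_q=\frac{(1-q^n)(1-q^{n-1})\cdots(1-q^{n-k+1})}{(1-q^k)(1-q^{k-1})\cdots(1-q)}$$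 if $0\le k\le n$, and $0$ otherwise. For an integer $r\ge 0$ and arbitrary points $A=(a,b)$, $A'=(a',b')$, $F=(c,d)$, $F'=(c',d')$ in $\mathbb Z^2$ (in this order), define $$f_{r,A,A',F,F'}(q)=q^{r(r+a'-a)}\begin{bmatrix}c-a+d-b\\ c-a+r\end{bmatrix}_q\begin{bmatrix}c'-a'+d'-b'\\ c'-a'-r\end{bmatrix}_q.$$ In particular, $f_{r,A_1,A_2,B_2,B_1}(q)=q^{r(r+x_2-x_1)}\begin{bmatrix}u_2-x_1+v_2-y_1\\ u_2-x_1+r\end{bmatrix}_q\begin{bmatrix}u_1-x_2+v_1-y_2\\ u_1-x_2-r\end{bmatrix}_q$. *)

theory Defs
  imports
    Complex_Main
    "HOL-Computational_Algebra.Polynomial"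
    "HOL-Computational_Algebra.Fraction_Field"
begin

type_synonym point = "int \<times> int"

datatype step = N | E

datatype path = Path (start: point) (steps: "step list")

definition vertex :: "path \<Rightarrow> nat \<Rightarrow> point" where
  "vertex P i = (fst (start P) + int (count_list (take i (steps P)) E),
                 snd (start P) + int (count_list (take i (steps P)) N))"

definition paths :: "point \<Rightarrow> point \<Rightarrow> path set" where
  "paths A B = {P. vertex P 0 = A \<and> vertex P (length (steps P)) = B}"

text \<open>The vertex at position \<open>i\<close> lies between the steps \<open>steps P ! (i - 1)\<close> and \<open>steps P ! i\<close>.\<close>

definition valleys :: "path \<Rightarrow> nat set" where
  "valleys P = {i. 0 < i \<and> i < length (steps P) \<and> steps P ! (i - 1) = E \<and> steps P ! i = N}"

definition maj :: "path \<Rightarrow> nat" where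
  "maj P = \<Sum>(valleys P)"

definition prec :: "point \<Rightarrow> point \<Rightarrow> bool" (infix "\<prec>" 50) where
  "A \<prec> B \<longleftrightarrow> fst A < fst B \<and> snd A > snd B"

text \<open>
  A common vertex may sit at different positions \<open>i\<close>, \<open>j\<close> on the two paths.
  The steps after it are \<open>steps P ! (i + k)\<close> and \<open>steps Q ! (j + k)\<close> for \<open>k = 0, 1, \<dots>\<close>;
  they are compared only as long as both exist.
\<close>

definition crossing :: "path \<Rightarrow> path \<Rightarrow> point \<Rightarrow> bool" where
  "crossing P Q C \<longleftrightarrow>
     (\<exists>i j k. 0 < i \<and> i \<le> length (steps P) \<and> vertex P i = C \<and>
              0 < j \<and> j \<le> length (steps Q) \<and> vertex Q j = C \<and>
              steps P ! (i - 1) \<noteq> steps Q ! (j - 1) \<and>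
              i + k < length (steps P) \<and> j + k < length (steps Q) \<and>
              (\<forall>l<k. steps P ! (i + l) = steps Q ! (j + l)) \<and>
              steps P ! (i + k) \<noteq> steps Q ! (j + k) \<and>
              steps P ! (i + k) = steps P ! (i - 1) \<and>
              steps Q ! (j + k) = steps Q ! (j - 1))"

definition num_crossings :: "path \<Rightarrow> path \<Rightarrow> nat" ("\<chi>") where
  "\<chi> P Q = card {C. crossing P Q C}"

definition path_pairs_ge :: "nat \<Rightarrow> point \<Rightarrow> point \<Rightarrow> point \<Rightarrow> point \<Rightarrow> (path \<times> path) set" where
  "path_pairs_ge r A B A' B' = {(P, Q). P \<in> paths A B \<and> Q \<in> paths A' B' \<and> \<chi> P Q \<ge> r}"

definition H_ge :: "'a::field \<Rightarrow> nat \<Rightarrow> point \<Rightarrow> point \<Rightarrow> point \<Rightarrow> point \<Rightarrow> 'a" where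
  "H_ge q r A B A' B' = (\<Sum>(P, Q)\<in>path_pairs_ge r A B A' B'. q ^ (maj P + maj Q))"

definition qbinomial :: "'a::field \<Rightarrow> int \<Rightarrow> int \<Rightarrow> 'a" where
  "qbinomial q n k =
     (if 0 \<le> k \<and> k \<le> n
      then (\<Prod>i\<in>{n - k + 1..n}. 1 - q powi i) / (\<Prod>i\<in>{1..k}. 1 - q powi i)
      else 0)"

fun f_prod :: "'a::field \<Rightarrow> nat \<Rightarrow> point \<Rightarrow> point \<Rightarrow> point \<Rightarrow> point \<Rightarrow> 'a" where
  "f_prod q r (a, b) (a', b') (c, d) (c', d') =
     q powi (int r * (int r + a' - a))
       * qbinomial q (c - a + d - b) (c - a + int r)
       * qbinomial q (c' - a' + d' - b') (c' - a' - int r)"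

text \<open>
  The identities are formal ones: \<open>q\<close> is the indeterminate in the field of rational functions
  (fractions of integer polynomials), so the denominators of the \<open>q\<close>-binomials are nonzero.
\<close>

definition indet :: "int poly fract" where
  "indet = Fract [:0, 1:] 1"


text \<open>The sums and cardinalities above and in the theorem range over finite sets.\<close>

lemma finite_paths: "finite (paths A B)"
proof -
  define n where "n = nat (fst B - fst A) + nat (snd B - snd A)"
  have len: "length ss = count_list ss E + count_list ss N" for ss
  proof (induction ss)
    case (Cons s ss)
    then show ?case by (cases s) auto
  qed simp
  have U: "(UNIV :: step set) = {N, E}"
    using step.exhaust by auto
  have "paths A B \<subseteq> Path A ` {ss. set ss \<subseteq> UNIV \<and> length ss \<le> n}"
  proof
    fix P assume "P \<in> paths A B"
    then have *: "start P = A" "length (steps P) \<le> n"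
      unfolding paths_def vertex_def n_def using len[of "steps P"] by (auto simp: prod_eq_iff)
    then show "P \<in> Path A ` {ss. set ss \<subseteq> UNIV \<and> length ss \<le> n}"
      by (cases P) auto
  qed
  moreover have "finite (Path A ` {ss. set ss \<subseteq> (UNIV :: step set) \<and> length ss \<le> n})"
    by (intro finite_imageI finite_lists_length_le) (simp add: U)
  ultimately show ?thesis by (rule finite_subset)
qed

lemma finite_path_pairs_ge: "finite (path_pairs_ge r A B A' B')"
  by (rule finite_subset[of _ "paths A B \<times> paths A' B'"])
     (auto simp: path_pairs_ge_def finite_paths)

lemma finite_valleys: "finite (valleys P)"
  by (simp add: valleys_def)

lemma finite_crossings: "finite {C. crossing P Q C}"
  by (rule finite_subset[of _ "vertex P ` {..length (steps P)}"]) (force simp: crossing_def)+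

lemma finite_f_prod_support: "finite {j. 1 \<le> j \<and> f_prod q (r + j) A A B B \<noteq> 0}"
proof (rule finite_subset)
  show "{j. 1 \<le> j \<and> f_prod q (r + j) A A B B \<noteq> 0} \<subseteq> {..nat (snd B - snd A)}"
  proof (cases A; cases B)
    fix x y u v assume [simp]: "A = (x, y)" "B = (u, v)"
    show ?thesis by (auto simp: qbinomial_def split: if_splits)
  qed
qed simp

end

theory Submission
  imports Defs
begin

text \<open>
  Let \<open>D t\<close> be the horizontal gap between the two paths after \<open>t\<close> steps of each. When the
  starting points lie on a common antidiagonal, the paths can only meet after equally many steps,
  \<open>D\<close> changes by at most one per step, and a crossing is a maximal run of zeros of \<open>D\<close> that
  separates a value \<open>1\<close> from a value \<open>-1\<close>. So \<open>\<chi>\<close> is the number of sign changes of \<open>D\<close>, zeros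
  being ignored (\<open>num_crossings_passages\<close>), and the proof computes the generating function of
  pairs of words with at least \<open>r\<close> sign changes by adding one step at a time. For this it is
  refined by the last step of each word, because that step decides whether a new step \<open>N\<close>
  creates a valley.

  The sign changes are counted by a counter (\<open>changes\<close>) that assumes a negative sign at the
  start, so that its parity always tells the current sign. Hence if the gap ends up \<open>\<ge> 0\<close> and \<open>r\<close>
  is even, or ends up \<open>\<le> 0\<close> and \<open>r\<close> is odd, the last step is irrelevant for the condition that
  the counter is at least \<open>r\<close>. In such a region the two words evolve independently, and every
  product
  \<open>q ^ (e (e + d)) * (gf of first words, shifted by e) * (gf of second words, shifted by - e)\<close>
  satisfies the same recurrence as the pairs. Across the border of the region, where the gap is
  \<open>\<plusminus>1\<close> on the wrong side, parity makes the thresholds \<open>r\<close> and \<open>r - 1\<close> equivalent, so that the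
  product found for \<open>r - 1\<close> provides the boundary values. At gap \<open>0\<close> the products for \<open>r\<close> and
  \<open>r - 1\<close> agree: this is the reflection identity \<open>shifted_gf_reflect\<close>, and it is what forces the
  exponent \<open>e (e + d)\<close>. Starting from \<open>r = 0\<close>, where nothing is restricted, this determines the
  generating function (\<open>pair_gf_same_length\<close>). If the lengths differ, the longer path goes on
  freely after the shorter one has ended (\<open>pair_gf_formula\<close>). Summing over the last steps turns
  the two factors into \<open>q\<close>-binomial coefficients, by the two \<open>q\<close>-Pascal rules.

  It remains to compare the counter with \<open>\<chi>\<close>. If the paths start at \<open>A1 \<prec> A2\<close>, the two are equal.
  If they start at the same point, the counters of \<open>(P, Q)\<close> and of \<open>(Q, P)\<close> are \<open>\<chi>\<close> and \<open>\<chi> + 1\<close> in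
  some order, unless \<open>D\<close> vanishes identically (\<open>cross_common_start\<close>). For different endpoints the
  order of the two paths can be chosen, according to the parity of \<open>r\<close>, so that counter and \<open>\<chi>\<close>
  reach \<open>r\<close> simultaneously. For equal endpoints, adding both orders gives
  \<open>H_ge r + H_ge (r + 1) = 2 f_prod (r + 1)\<close> for \<open>r \<ge> 1\<close>, which unfolds to the alternating sum.
\<close>

section \<open>The major index of a word, one step at a time\<close>

definition east :: "step list \<Rightarrow> int" where
  "east w = int (count_list w E)"

definition dx :: "step \<Rightarrow> int" where
  "dx s = (if s = E then 1 else 0)"

text \<open>
  The empty word is treated as if it ended in \<open>N\<close>, because a step \<open>N\<close> appended to it creates no
  valley. With this convention all recurrences below start at length \<open>0\<close>.
\<close>

definition end_step :: "step list \<Rightarrow> step" where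
  "end_step w = (if w = [] then N else last w)"

definition word_maj :: "step list \<Rightarrow> nat" where
  "word_maj w = \<Sum>{i. 0 < i \<and> i < length w \<and> w ! (i - 1) = E \<and> w ! i = N}"

definition words :: "nat \<Rightarrow> step \<Rightarrow> int \<Rightarrow> step list set" where
  "words n s k = {w. length w = n \<and> east w = k \<and> end_step w = s}"

lemma east_simps [simp]: "east [] = 0" "east (w @ [s]) = east w + dx s"
  by (auto simp: east_def dx_def)

lemma end_step_simps [simp]: "end_step [] = N" "end_step (w @ [s]) = s"
  by (auto simp: end_step_def)

lemma dx_simps [simp]: "dx E = 1" "dx N = 0"
  by (auto simp: dx_def)

lemma step_UNIV: "(UNIV :: step set) = {E, N}"
  using step.exhaust by auto

lemma finite_words [simp]: "finite (words n s k)"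
proof -
  have "words n s k \<subseteq> {w. set w \<subseteq> UNIV \<and> length w = n}"
    by (auto simp: words_def)
  then show ?thesis
    by (rule finite_subset) (intro finite_lists_length_eq, simp add: step_UNIV)
qed

lemma word_maj_snoc:
  "word_maj (w @ [t]) = word_maj w + (if end_step w = E \<and> t = N then length w else 0)"
proof -
  let ?V = "\<lambda>w. {i. 0 < i \<and> i < length w \<and> w ! (i - 1) = E \<and> w ! i = N}"
  let ?J = "if end_step w = E \<and> t = N then {length w} else {}"
  have "?V (w @ [t]) = ?V w \<union> ?J"
    by (auto simp: nth_append end_step_def last_conv_nth less_Suc_eq split: if_splits)
  then have "word_maj (w @ [t]) = \<Sum>(?V w \<union> ?J)"
    by (simp only: word_maj_def)
  also have "\<dots> = \<Sum>(?V w) + \<Sum>?J"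
    by (rule sum.union_disjoint) auto
  finally show ?thesis
    by (simp add: word_maj_def)
qed

lemma words_Suc:
  "words (Suc n) t k = (\<lambda>w. w @ [t]) ` (words n E (k - dx t) \<union> words n N (k - dx t))"
proof -
  have "w \<in> (\<lambda>w. w @ [t]) ` (words n E (k - dx t) \<union> words n N (k - dx t))"
    if "w \<in> words (Suc n) t k" for w
  proof -
    from that obtain v s where w: "w = v @ [s]"
      by (cases w rule: rev_cases) (auto simp: words_def)
    with that have "s = t" "v \<in> words n (end_step v) (k - dx t)"
      by (auto simp: words_def)
    moreover have "end_step v = E \<or> end_step v = N"
      using step.exhaust by blast
    ultimately show ?thesis using w by auto
  qed
  then show ?thesis by (auto simp: words_def)
qed

lemma sum_words_Suc:
  "(\<Sum>w\<in>words (Suc n) t k. F w) = (\<Sum>s\<in>{E, N}. \<Sum>w\<in>words n s (k - dx t). F (w @ [t]))"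
proof -
  have "words n E (k - dx t) \<inter> words n N (k - dx t) = {}"
    by (auto simp: words_def)
  then show ?thesis
    by (simp add: words_Suc sum.reindex inj_on_def sum.union_disjoint)
qed

text \<open>
  The factor by which the weight of a word of length \<open>n\<close> ending in \<open>s\<close> grows when \<open>t\<close> is appended:
  the only valley that can arise sits at position \<open>n\<close>.
\<close>

definition turn :: "'a::field \<Rightarrow> nat \<Rightarrow> step \<Rightarrow> step \<Rightarrow> 'a" where
  "turn q n s t = (if s = E \<and> t = N then q ^ n else 1)"

lemma word_maj_weight:
  "w \<in> words n s k \<Longrightarrow> q ^ word_maj (w @ [t]) = turn q n s t * q ^ word_maj w"
  by (auto simp: words_def word_maj_snoc turn_def power_add)

definition maj_gf :: "'a::field \<Rightarrow> nat \<Rightarrow> step \<Rightarrow> int \<Rightarrow> 'a" where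
  "maj_gf q n s k = (\<Sum>w\<in>words n s k. q ^ word_maj w)"

lemma maj_gf_Suc:
  "maj_gf q (Suc n) t k = (\<Sum>s\<in>{E, N}. turn q n s t * maj_gf q n s (k - dx t))"
  unfolding maj_gf_def sum_words_Suc sum_distrib_left
  by (rule sum.cong[OF refl], rule sum.cong[OF refl], rule word_maj_weight)

lemma words_0: "words 0 s k = (if s = N \<and> k = 0 then {[]} else {})"
  by (auto simp: words_def)

lemma maj_gf_0: "maj_gf q 0 s k = (if s = N \<and> k = 0 then 1 else 0)"
  by (auto simp: maj_gf_def words_0 word_maj_def)

section \<open>\<open>q\<close>-binomial coefficients\<close>

text \<open>
  Exactly what the \<open>q\<close>-binomial formulas need from \<open>q\<close>: the denominators do not vanish and negative
  powers make sense.
\<close>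

definition generic :: "'a::field \<Rightarrow> bool" where
  "generic q \<longleftrightarrow> q \<noteq> 0 \<and> (\<forall>n>0. q ^ n \<noteq> 1)"

text \<open>The \<open>q\<close>-factorial without its usual normalisation by \<open>(1 - q) ^ n\<close>.\<close>

definition qfact :: "'a::field \<Rightarrow> nat \<Rightarrow> 'a" where
  "qfact q n = (\<Prod>i=1..n. 1 - q ^ i)"

lemma qfact_0 [simp]: "qfact q 0 = 1"
  and qfact_Suc [simp]: "qfact q (Suc n) = qfact q n * (1 - q ^ Suc n)"
  by (simp_all add: qfact_def)

lemma qfact_nonzero: "generic q \<Longrightarrow> qfact q n \<noteq> 0"
  by (auto simp: qfact_def generic_def)

lemma prod_powi_eq_qfact:
  "(\<Prod>i\<in>{1..int n}. 1 - q powi i) = qfact q n"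
proof (induction n)
  case (Suc n)
  have "{1..int (Suc n)} = insert (int (Suc n)) {1..int n}" by auto
  then show ?case using Suc by (simp add: mult.commute power_int_def nat_add_distrib)
qed simp

lemma qbinomial_qfact:
  assumes "generic q" and "k \<le> n"
  shows "qbinomial q (int n) (int k) = qfact q n / (qfact q k * qfact q (n - k))"
proof -
  have "{1..int n} = {1..int (n - k)} \<union> {int n - int k + 1..int n}"
    using assms(2) by (auto simp: of_nat_diff)
  moreover have "{1..int (n - k)} \<inter> {int n - int k + 1..int n} = {}"
    using assms(2) by (auto simp: of_nat_diff)
  ultimately have "qfact q n = qfact q (n - k) * (\<Prod>i\<in>{int n - int k + 1..int n}. 1 - q powi i)"
    by (simp add: prod_powi_eq_qfact[symmetric] prod.union_disjoint)
  then show ?thesis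
    using assms qfact_nonzero[OF assms(1)]
    by (simp add: qbinomial_def prod_powi_eq_qfact field_simps)
qed

lemma qbinomial_zero [simp]: "k < 0 \<Longrightarrow> qbinomial q n k = 0" "n < k \<Longrightarrow> qbinomial q n k = 0"
  by (auto simp: qbinomial_def)

lemma qbinomial_edges:
  assumes "generic q"
  shows "qbinomial q (int n) 0 = 1" "qbinomial q (int n) (int n) = 1"
  using qbinomial_qfact[OF assms, of 0 n] qbinomial_qfact[OF assms, of n n] qfact_nonzero[OF assms]
  by auto

text \<open>
  Both rules come from splitting \<open>1 - q ^ (n + 1)\<close> as \<open>(1 - q ^ a) + q ^ a (1 - q ^ b)\<close> with
  \<open>a + b = n + 1\<close>; the two choices of \<open>a\<close> as an index of the denominator give the two rules.
\<close>

lemma qbinomial_pascal_nat: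
  assumes g: "generic q" and "k < n"
  shows "qbinomial q (int n + 1) (int k + 1)
           = qbinomial q (int n) (int k) + q ^ (k + 1) * qbinomial q (int n) (int k + 1)"
    and "qbinomial q (int n + 1) (int k + 1)
           = qbinomial q (int n) (int k + 1) + q ^ (n - k) * qbinomial q (int n) (int k)"
proof -
  from \<open>k < n\<close> obtain l where n: "n = Suc (k + l)"
    using less_imp_Suc_add by blast
  note nz = qfact_nonzero[OF g, of k] qfact_nonzero[OF g, of l] qfact_nonzero[OF g, of "Suc k"]
    qfact_nonzero[OF g, of "Suc l"]
  have b: "qbinomial q (int n + 1) (int k + 1) = qfact q (Suc n) / (qfact q (Suc k) * qfact q (Suc l))"
    "qbinomial q (int n) (int k) = qfact q n / (qfact q k * qfact q (Suc l))"
    "qbinomial q (int n) (int k + 1) = qfact q n / (qfact q (Suc k) * qfact q l)"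
    using qbinomial_qfact[OF g, of "Suc k" "Suc n"] qbinomial_qfact[OF g, of k n]
      qbinomial_qfact[OF g, of "Suc k" n] by (simp_all add: n add.commute)
  have split: "x / (a * b) = y / (a' * b) + c * (y / (a * b'))"
    if "x = y * z" "a = a' * a1" "b = b' * b1" "z = a1 + c * b1" "a \<noteq> 0" "b \<noteq> 0"
    for x y z a b a' b' a1 b1 c :: 'a
    using that by (simp add: field_simps)
  show "qbinomial q (int n + 1) (int k + 1)
          = qbinomial q (int n) (int k) + q ^ (k + 1) * qbinomial q (int n) (int k + 1)"
    unfolding b by (rule split[where z = "1 - q ^ Suc n" and ?a1.0 = "1 - q ^ Suc k" and ?b1.0 = "1 - q ^ Suc l"])
      (use nz in \<open>simp_all add: n algebra_simps power_add\<close>)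
  have "qfact q (Suc n) / (qfact q (Suc l) * qfact q (Suc k))
    = qfact q n / (qfact q l * qfact q (Suc k)) + q ^ (n - k) * (qfact q n / (qfact q (Suc l) * qfact q k))"
    by (rule split[where z = "1 - q ^ Suc n" and ?a1.0 = "1 - q ^ Suc l" and ?b1.0 = "1 - q ^ Suc k"])
      (use nz in \<open>simp_all add: n algebra_simps power_add\<close>)
  then show "qbinomial q (int n + 1) (int k + 1)
           = qbinomial q (int n) (int k + 1) + q ^ (n - k) * qbinomial q (int n) (int k)"
    unfolding b by (simp add: mult.commute)
qed

text \<open>
  For arbitrary integers \<open>k\<close> the second rule is stated after multiplication by \<open>q powi k\<close>: this
  avoids the exponent \<open>n + 1 - k\<close>, and it is the form in which words ending in \<open>N\<close> use it.
\<close>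

lemma qbinomial_pascal:
  assumes g: "generic q"
  shows "qbinomial q (int n + 1) k = qbinomial q (int n) (k - 1) + q powi k * qbinomial q (int n) k"
    and "q powi k * qbinomial q (int n + 1) k
           = q powi k * qbinomial q (int n) k + q ^ (n + 1) * qbinomial q (int n) (k - 1)"
proof -
  have "k < 0 \<or> k = 0 \<or> k = int n + 1 \<or> k > int n + 1 \<or> (0 < k \<and> k < int n + 1)" by linarith
  moreover have "\<exists>j. k = int j + 1 \<and> j < n" if "0 < k \<and> k < int n + 1"
    using that by (intro exI[of _ "nat (k - 1)"]) auto
  ultimately consider "k < 0" | "k = 0" | "k = int n + 1" | "k > int n + 1" | j where "k = int j + 1" "j < n"
    by blast
  note cases = this
  have e: "qbinomial q (int n + 1) 0 = 1" "qbinomial q (int n + 1) (int n + 1) = 1"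
    using qbinomial_edges[OF g, of "Suc n"] by (simp_all add: add.commute)
  show "qbinomial q (int n + 1) k = qbinomial q (int n) (k - 1) + q powi k * qbinomial q (int n) k"
    by (cases rule: cases)
      (use qbinomial_edges[OF g, of n] e qbinomial_pascal_nat(1)[OF g, of _ n] in
       \<open>auto simp: power_int_def nat_add_distrib\<close>)
  show "q powi k * qbinomial q (int n + 1) k
           = q powi k * qbinomial q (int n) k + q ^ (n + 1) * qbinomial q (int n) (k - 1)"
  proof (cases rule: cases)
    case (5 j)
    have "q powi k * q ^ (n - j) = q ^ (n + 1)"
      using 5 by (simp add: power_int_def nat_add_distrib flip: power_add power_Suc)
    then show ?thesis
      using qbinomial_pascal_nat(2)[OF g \<open>j < n\<close>] 5
      by (simp add: distrib_left flip: mult.assoc)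
  qed (use qbinomial_edges[OF g, of n] e in \<open>auto simp: power_int_def nat_add_distrib\<close>)
qed

text \<open>
  The two \<open>q\<close>-Pascal rules are precisely the recurrences for appending \<open>E\<close> and for appending \<open>N\<close>.
\<close>

lemma maj_gf_qbinomial:
  assumes g: "generic q"
  shows "maj_gf q (Suc n) E k = qbinomial q (int n) (k - 1) \<and>
         maj_gf q (Suc n) N k = q powi k * qbinomial q (int n) k"
proof (induction n arbitrary: k)
  case 0
  have "qbinomial q 0 k = (if k = 0 then 1 else 0)" for k
    using qbinomial_edges[OF g, of 0] by (auto simp: neq_iff)
  then show ?case by (simp add: maj_gf_Suc maj_gf_0 turn_def)
next
  case (Suc n)
  have "maj_gf q (Suc (Suc n)) E k = qbinomial q (int n + 1) (k - 1)"
    using qbinomial_pascal(1)[OF g, of n "k - 1"]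
    by (simp add: maj_gf_Suc[of q "Suc n"] Suc turn_def)
  moreover have "maj_gf q (Suc (Suc n)) N k = q powi k * qbinomial q (int n + 1) k"
    using qbinomial_pascal(2)[OF g, of k n]
    by (simp add: maj_gf_Suc[of q "Suc n"] Suc turn_def add.commute)
  ultimately show ?case by (simp add: add.commute)
qed

text \<open>Appending \<open>E\<close> never creates a valley, so all words of length \<open>n\<close> reappear as the words of
  length \<open>n + 1\<close> that end in \<open>E\<close>.\<close>

lemma maj_gf_total:
  assumes "generic q"
  shows "(\<Sum>s\<in>{E, N}. maj_gf q n s k) = qbinomial q (int n) k"
  using maj_gf_qbinomial[OF assms, of n "k + 1"] by (simp add: maj_gf_Suc turn_def)

text \<open>The last step can be exchanged at the cost of a power of \<open>q\<close>. This is the source of the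
  reflection principle for pairs.\<close>

lemma maj_gf_N_E:
  assumes "generic q"
  shows "maj_gf q (Suc n) N k = q powi k * maj_gf q (Suc n) E (k + 1)"
  using maj_gf_qbinomial[OF assms] by simp


section \<open>Counting sign changes of the gap\<close>

text \<open>
  The counter starts at \<open>0\<close>, as if the gap were negative before the start, and its parity stores the
  last nonzero sign: even for negative, odd for positive. It increases when the new gap \<open>g\<close> has the
  opposite sign.
\<close>

definition bump :: "int \<Rightarrow> nat \<Rightarrow> nat" where
  "bump g c = (if (0 < g \<and> even c) \<or> (g < 0 \<and> odd c) then Suc c else c)"

primrec changes :: "(nat \<Rightarrow> int) \<Rightarrow> nat \<Rightarrow> nat" where
  "changes D 0 = 0"
| "changes D (Suc n) = bump (D (Suc n)) (changes D n)"

text \<open>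
  Here \<open>d\<close> is the horizontal distance from the first starting point to the second, so that the gap
  starts at \<open>- d\<close>; it is positive when the first path is to the right.
\<close>

definition gap :: "int \<Rightarrow> step list \<Rightarrow> step list \<Rightarrow> nat \<Rightarrow> int" where
  "gap d u v t = east (take t u) - east (take t v) - d"

definition cross :: "int \<Rightarrow> step list \<Rightarrow> step list \<Rightarrow> nat" where
  "cross d u v = changes (gap d u v) (min (length u) (length v))"

lemma changes_cong: "(\<And>t. t \<le> n \<Longrightarrow> D t = D' t) \<Longrightarrow> changes D n = changes D' n"
  by (induction n) auto

lemma changes_parity:
  assumes "D 0 \<le> 0"
  shows "(0 < D n \<longrightarrow> odd (changes D n)) \<and> (D n < 0 \<longrightarrow> even (changes D n))"
  using assms by (cases n) (auto simp: bump_def)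

lemma changes_le: "changes D n \<le> n"
  by (induction n) (auto simp: bump_def)

lemma cross_snoc:
  assumes "length u = length v"
  shows "cross d (u @ [a]) (v @ [b]) = bump (east u - east v - d + dx a - dx b) (cross d u v)"
proof -
  have "changes (gap d (u @ [a]) (v @ [b])) (length v) = changes (gap d u v) (length v)"
    using assms by (intro changes_cong) (auto simp: gap_def)
  then show ?thesis
    using assms by (simp add: cross_def gap_def algebra_simps)
qed

lemma cross_snoc_longer:
  shows "length u \<le> length v \<Longrightarrow> cross d u (v @ [b]) = cross d u v"
    and "length v \<le> length u \<Longrightarrow> cross d (u @ [a]) v = cross d u v"
  by (auto simp: cross_def gap_def intro!: changes_cong)

lemma cross_parity:
  assumes "0 \<le> d" and "t = min (length u) (length v)"
  shows "0 < gap d u v t \<Longrightarrow> odd (cross d u v)" and "gap d u v t < 0 \<Longrightarrow> even (cross d u v)"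
  using changes_parity[of "gap d u v" t] assms by (auto simp: cross_def gap_def)

section \<open>The generating function of pairs with many sign changes\<close>

definition pair_gf ::
  "'a::field \<Rightarrow> nat \<Rightarrow> int \<Rightarrow> nat \<Rightarrow> nat \<Rightarrow> step \<Rightarrow> step \<Rightarrow> int \<Rightarrow> int \<Rightarrow> 'a" where
  "pair_gf q r d p n a b i j =
     (\<Sum>u\<in>words p a i. \<Sum>v\<in>words n b j.
        if r \<le> cross d u v then q ^ word_maj u * q ^ word_maj v else 0)"

text \<open>
  The closed half-line of final gaps for which the last step cannot push the counter from below
  \<open>r\<close> to \<open>r\<close>: a step onto the positive side only ever produces odd values of the counter, and a
  step onto the negative side only even ones.
\<close>

definition side :: "nat \<Rightarrow> int \<Rightarrow> bool" where
  "side r g \<longleftrightarrow> (if even r then 0 \<le> g else g \<le> 0)"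

lemma le_bump_iff: "side r g \<Longrightarrow> r \<le> bump g c \<longleftrightarrow> r \<le> c"
  unfolding side_def bump_def by (auto simp: le_Suc_eq split: if_splits)

lemma pair_gf_Suc_Suc:
  assumes "side r (i - j - d)"
  shows "pair_gf q r d (Suc n) (Suc n) a b i j =
    (\<Sum>a'\<in>{E, N}. \<Sum>b'\<in>{E, N}. turn q n a' a * turn q n b' b *
       pair_gf q r d n n a' b' (i - dx a) (j - dx b))"
proof -
  let ?F = "\<lambda>u v. if r \<le> cross d u v then q ^ word_maj u * q ^ word_maj v else 0"
  have "?F (u @ [a]) (v @ [b]) = turn q n a' a * turn q n b' b * ?F u v"
    if "u \<in> words n a' (i - dx a)" "v \<in> words n b' (j - dx b)" for u v a' b'
  proof -
    have "r \<le> cross d (u @ [a]) (v @ [b]) \<longleftrightarrow> r \<le> cross d u v"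
      using that assms by (subst cross_snoc) (auto simp: words_def le_bump_iff algebra_simps)
    then show ?thesis
      using that by (simp add: word_maj_weight)
  qed
  then have "pair_gf q r d (Suc n) (Suc n) a b i j =
    (\<Sum>a'\<in>{E, N}. \<Sum>u\<in>words n a' (i - dx a). \<Sum>b'\<in>{E, N}. \<Sum>v\<in>words n b' (j - dx b).
       turn q n a' a * turn q n b' b * ?F u v)"
    unfolding pair_gf_def sum_words_Suc by (intro sum.cong refl)
  also have "\<dots> = (\<Sum>a'\<in>{E, N}. \<Sum>b'\<in>{E, N}. \<Sum>u\<in>words n a' (i - dx a). \<Sum>v\<in>words n b' (j - dx b).
       turn q n a' a * turn q n b' b * ?F u v)"
    by (intro sum.cong[OF refl] sum.swap)
  finally show ?thesis
    unfolding pair_gf_def sum_distrib_left .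
qed

lemma pair_gf_Suc_right:
  assumes "p \<le> n"
  shows "pair_gf q r d p (Suc n) a b i j =
    (\<Sum>b'\<in>{E, N}. turn q n b' b * pair_gf q r d p n a b' i (j - dx b))"
proof -
  let ?F = "\<lambda>u v. if r \<le> cross d u v then q ^ word_maj u * q ^ word_maj v else 0"
  have "?F u (v @ [b]) = turn q n b' b * ?F u v"
    if "u \<in> words p a i" "v \<in> words n b' (j - dx b)" for u v b'
    using that assms cross_snoc_longer(1)[of u v d b]
    by (auto simp: word_maj_weight) (auto simp: words_def)
  then have "pair_gf q r d p (Suc n) a b i j =
    (\<Sum>u\<in>words p a i. \<Sum>b'\<in>{E, N}. \<Sum>v\<in>words n b' (j - dx b). turn q n b' b * ?F u v)"
    unfolding pair_gf_def sum_words_Suc by (intro sum.cong refl)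
  also have "\<dots> = (\<Sum>b'\<in>{E, N}. \<Sum>u\<in>words p a i. \<Sum>v\<in>words n b' (j - dx b). turn q n b' b * ?F u v)"
    by (rule sum.swap)
  finally show ?thesis
    unfolding pair_gf_def sum_distrib_left .
qed

lemma pair_gf_Suc_left:
  assumes "n \<le> p"
  shows "pair_gf q r d (Suc p) n a b i j =
    (\<Sum>a'\<in>{E, N}. turn q p a' a * pair_gf q r d p n a' b (i - dx a) j)"
proof -
  let ?F = "\<lambda>u v. if r \<le> cross d u v then q ^ word_maj u * q ^ word_maj v else 0"
  have "?F (u @ [a]) v = turn q p a' a * ?F u v"
    if "u \<in> words p a' (i - dx a)" "v \<in> words n b j" for u v a'
    using that assms cross_snoc_longer(2)[of v u d a]
    by (auto simp: word_maj_weight) (auto simp: words_def)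
  then show ?thesis
    unfolding pair_gf_def sum_words_Suc sum_distrib_left by (intro sum.cong refl)
qed

text \<open>
  All pairs of words from the starting points moved apart by \<open>e\<close> along the antidiagonal, the first to
  the left and the second to the right, with a normalising power of \<open>q\<close>. Because of the product
  form it obeys the recurrences of unrestricted pairs for every \<open>e\<close>.
\<close>

definition shifted_gf ::
  "'a::field \<Rightarrow> int \<Rightarrow> int \<Rightarrow> nat \<Rightarrow> nat \<Rightarrow> step \<Rightarrow> step \<Rightarrow> int \<Rightarrow> int \<Rightarrow> 'a" where
  "shifted_gf q d e p n a b i j =
     q powi (e * (e + d)) * maj_gf q p a (i + e) * maj_gf q n b (j - e)"

lemma shifted_gf_Suc_left:
  "shifted_gf q d e (Suc p) n a b i j =
     (\<Sum>a'\<in>{E, N}. turn q p a' a * shifted_gf q d e p n a' b (i - dx a) j)"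
  by (simp add: shifted_gf_def maj_gf_Suc algebra_simps)

lemma shifted_gf_Suc_right:
  "shifted_gf q d e p (Suc n) a b i j =
     (\<Sum>b'\<in>{E, N}. turn q n b' b * shifted_gf q d e p n a b' i (j - dx b))"
  by (simp add: shifted_gf_def maj_gf_Suc algebra_simps)

lemma shifted_gf_Suc_Suc:
  "shifted_gf q d e (Suc p) (Suc n) a b i j =
    (\<Sum>a'\<in>{E, N}. \<Sum>b'\<in>{E, N}. turn q p a' a * turn q n b' b *
       shifted_gf q d e p n a' b' (i - dx a) (j - dx b))"
  by (simp add: shifted_gf_Suc_left[of q d e p] shifted_gf_Suc_right[of q d e p] algebra_simps)

text \<open>
  When both words end at the same point with different last steps, \<open>maj_gf_N_E\<close> exchanges these
  steps. Reading the product with the roles of its factors interchanged then amounts to another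
  shift \<open>e\<close>, and the powers of \<open>q\<close> match because of the normalisation \<open>e (e + d)\<close>.
\<close>

lemma shifted_gf_reflect:
  assumes g: "generic q"
  shows "shifted_gf q d e (Suc n) (Suc n) E N (j + d) j
           = shifted_gf q d (1 - e - d) (Suc n) (Suc n) E N (j + d) j"
    and "shifted_gf q d e (Suc n) (Suc n) N E (j + d) j
           = shifted_gf q d (- 1 - e - d) (Suc n) (Suc n) N E (j + d) j"
proof -
  have [simp]: "q \<noteq> 0" using g by (simp add: generic_def)
  have combine: "q powi m * x * (q powi k * y) = q powi (m + k) * (x * y)"
    "q powi m * (q powi k * x) * y = q powi (m + k) * (x * y)" for m k x y
    by (simp_all add: power_int_add)
  have "e * (e + d) + (j - e) = (1 - e - d) * (1 - e - d + d) + (j - (1 - e - d))"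
    "e * (e + d) + (j + d + e) = (- 1 - e - d) * (- 1 - e - d + d) + (j + d + (- 1 - e - d))"
    by (simp_all add: algebra_simps)
  moreover have "j - e + 1 = j + d + (1 - e - d)" "j - (1 - e - d) + 1 = j + d + e"
    "j + d + (- 1 - e - d) + 1 = j - e" "j - (- 1 - e - d) = j + d + e + 1" by simp_all
  ultimately show "shifted_gf q d e (Suc n) (Suc n) E N (j + d) j
           = shifted_gf q d (1 - e - d) (Suc n) (Suc n) E N (j + d) j"
    and "shifted_gf q d e (Suc n) (Suc n) N E (j + d) j
           = shifted_gf q d (- 1 - e - d) (Suc n) (Suc n) N E (j + d) j"
    unfolding shifted_gf_def maj_gf_N_E[OF g] combine by (simp_all only: mult.commute mult.left_commute)
qed

text \<open>
  The shift that belongs to the threshold \<open>r\<close>. The two parities are related by the reflections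
  \<open>e \<mapsto> \<plusminus>1 - e - d\<close>, and \<open>e (e + d)\<close> is \<open>r (r + d)\<close> in both cases.
\<close>

definition shift :: "nat \<Rightarrow> int \<Rightarrow> int" where
  "shift r d = (if even r then int r else - int r - d)"

lemma pair_gf_0: "pair_gf q 0 d p n a b i j = shifted_gf q d (shift 0 d) p n a b i j"
  by (simp add: pair_gf_def shifted_gf_def shift_def maj_gf_def sum_product)

text \<open>
  On the open half-line opposite to \<open>side r\<close> the counter has the parity of \<open>r\<close>, hence is never
  equal to \<open>r - 1\<close>.
\<close>

lemma pair_gf_strict_side:
  assumes "0 \<le> d" and "0 < r" and "\<not> side r (i - j - d)"
  shows "pair_gf q r d n n a b i j = pair_gf q (r - 1) d n n a b i j"
proof -
  have "r \<le> cross d u v \<longleftrightarrow> r - 1 \<le> cross d u v"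
    if "u \<in> words n a i" "v \<in> words n b j" for u v
  proof -
    have "gap d u v n = i - j - d"
      using that by (simp add: gap_def words_def)
    moreover have "min (length u) (length v) = n"
      using that by (simp add: words_def)
    ultimately have "even (cross d u v) \<longleftrightarrow> even r"
      using cross_parity[OF assms(1) refl, of u v] assms(3) by (auto simp: side_def split: if_splits)
    then have "cross d u v \<noteq> r - 1" using assms(2) by auto
    then show ?thesis using assms(2) by linarith
  qed
  then show ?thesis unfolding pair_gf_def by (intro sum.cong refl) auto
qed

text \<open>
  Removing the last step of both words stays on the side of \<open>r\<close>, except when the final gap is \<open>0\<close>
  and the previous one was \<open>\<plusminus>1\<close> on the other side. There the formula for \<open>r - 1\<close> applies, and
  the reflection identity turns it into the one for \<open>r\<close>.
\<close>

lemma pair_gf_same_length: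
  assumes g: "generic q" and d: "0 \<le> d" and "side r (i - j - d)"
  shows "pair_gf q r d n n a b i j = shifted_gf q d (shift r d) n n a b i j"
  using assms(3)
proof (induction n arbitrary: r a b i j)
  case 0
  show ?case
  proof (cases "r = 0")
    case False
    \<comment> \<open>Without steps there is no sign change, and the shifted starting points lie strictly on the
      other side of the border: both generating functions vanish.\<close>
    then have "i + shift r d \<noteq> 0 \<or> j - shift r d \<noteq> 0"
      using "0.prems" d by (auto simp: side_def shift_def split: if_splits)
    then show ?thesis
      using False by (auto simp: pair_gf_def shifted_gf_def maj_gf_0 words_0 cross_def)
  qed (simp only: pair_gf_0)
next
  case (Suc n)
  define i' j' where ij': "i' = i - dx a" "j' = j - dx b"
  consider "r = 0" | "side r (i' - j' - d)" | "0 < r" "\<not> side r (i' - j' - d)" by auto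
  then show ?case
  proof cases
    case 1
    then show ?thesis by (simp only: pair_gf_0)
  next
    case 2
    then show ?thesis
      unfolding pair_gf_Suc_Suc[OF Suc.prems] shifted_gf_Suc_Suc by (simp add: Suc.IH ij')
  next
    case 3
    have "side (r - 1) (i' - j' - d)"
      using 3 by (auto simp: side_def split: if_splits)
    then have "pair_gf q r d n n a' b' i' j' = shifted_gf q d (shift (r - 1) d) n n a' b' i' j'" for a' b'
      by (simp only: pair_gf_strict_side[OF d 3] Suc.IH[OF \<open>side (r - 1) (i' - j' - d)\<close>])
    then have "pair_gf q r d (Suc n) (Suc n) a b i j
        = shifted_gf q d (shift (r - 1) d) (Suc n) (Suc n) a b i j"
      unfolding pair_gf_Suc_Suc[OF Suc.prems] shifted_gf_Suc_Suc ij' by simp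
    \<comment> \<open>The gap jumps over the border, which leaves only one choice of last steps, with final gap 0.\<close>
    also have "\<dots> = shifted_gf q d (shift r d) (Suc n) (Suc n) a b i j"
    proof (cases "even r")
      case True
      then have "a = E" "b = N" "i = j + d"
        using 3 Suc.prems step.exhaust by (auto simp: side_def ij' dx_def split: if_splits)
      moreover have "shift (r - 1) d = 1 - shift r d - d"
        using True 3 by (simp add: shift_def of_nat_diff)
      ultimately show ?thesis using shifted_gf_reflect(1)[OF g] by metis
    next
      case False
      then have "a = N" "b = E" "i = j + d"
        using 3 Suc.prems step.exhaust by (auto simp: side_def ij' dx_def split: if_splits)
      moreover have "shift (r - 1) d = - 1 - shift r d - d"
        using False 3 by (simp add: shift_def of_nat_diff)
      ultimately show ?thesis using shifted_gf_reflect(2)[OF g] by metis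
    qed
    finally show ?thesis .
  qed
qed

text \<open>
  Once the first word has ended, the second one grows without affecting the counter. The predicate
  \<open>R\<close> describes final points whose predecessors, back to the time \<open>p\<close>, all lie where the formula
  for equal lengths holds.
\<close>

lemma pair_gf_extend_right:
  assumes "p \<le> n" and "R n j"
    and "\<And>m j. R (Suc m) j \<Longrightarrow> R m j \<and> R m (j - 1)"
    and "\<And>b j. R p j \<Longrightarrow> pair_gf q r d p p a b i j = shifted_gf q d e p p a b i j"
  shows "pair_gf q r d p n a b i j = shifted_gf q d e p n a b i j"
  using assms(1,2)
proof (induction n arbitrary: b j rule: dec_induct)
  case base
  then show ?case by (rule assms(4))
next
  case (step n)
  have "R n (j - dx b)"
    using assms(3)[OF step.prems] by (simp add: dx_def)
  then show ?case
    using step.hyps step.IH by (simp add: pair_gf_Suc_right shifted_gf_Suc_right)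
qed

lemma pair_gf_extend_left:
  assumes "n \<le> p" and "R p i"
    and "\<And>m i. R (Suc m) i \<Longrightarrow> R m i \<and> R m (i - 1)"
    and "\<And>a i. R n i \<Longrightarrow> pair_gf q r d n n a b i j = shifted_gf q d e n n a b i j"
  shows "pair_gf q r d p n a b i j = shifted_gf q d e p n a b i j"
  using assms(1,2)
proof (induction p arbitrary: a i rule: dec_induct)
  case base
  then show ?case by (rule assms(4))
next
  case (step p)
  have "R p (i - dx a)"
    using assms(3)[OF step.prems] by (simp add: dx_def)
  then show ?case
    using step.hyps step.IH by (simp add: pair_gf_Suc_left shifted_gf_Suc_left)
qed

text \<open>
  The two conditions compare the abscissas and the ordinates of the endpoints. If they hold, then
  whichever path is longer, at the time when the shorter one ends the gap is on the side of \<open>r\<close>: the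
  longer path has by then neither more \<open>E\<close> nor more \<open>N\<close> than in total.
\<close>

lemma pair_gf_formula:
  assumes g: "generic q" and d: "0 \<le> d"
    and x: "side r (i - j - d)" and y: "side r (i - j - d - (int p - int n))"
  shows "pair_gf q r d p n a b i j = shifted_gf q d (shift r d) p n a b i j"
proof -
  note base = pair_gf_same_length[OF g d]
  consider "p \<le> n" "even r" | "p \<le> n" "odd r" | "n \<le> p" "even r" | "n \<le> p" "odd r"
    using nat_le_linear by blast
  then show ?thesis
  proof cases
    case 1
    show ?thesis
      by (rule pair_gf_extend_right[where R = "\<lambda>m j. j + d \<le> i"])
        (use 1 x in \<open>auto simp: side_def intro!: base\<close>)
  next
    case 2
    show ?thesis
      by (rule pair_gf_extend_right[where R = "\<lambda>m j. i - j - d - (int p - int m) \<le> 0"])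
        (use 2 y in \<open>auto simp: side_def intro!: base\<close>)
  next
    case 3
    show ?thesis
      by (rule pair_gf_extend_left[where R = "\<lambda>m i. 0 \<le> i - j - d - (int m - int n)"])
        (use 3 y in \<open>auto simp: side_def intro!: base\<close>)
  next
    case 4
    show ?thesis
      by (rule pair_gf_extend_left[where R = "\<lambda>m i. i \<le> j + d"])
        (use 4 x in \<open>auto simp: side_def intro!: base\<close>)
  qed
qed


section \<open>Crossings are sign changes\<close>

text \<open>
  The positions at which \<open>D\<close> enters a run of zeros that it leaves, before or at time \<open>n\<close>, with the
  opposite sign. Each such run is recorded by its first position, where the steps arriving
  at the common vertex differ.
\<close>

definition passages :: "(nat \<Rightarrow> int) \<Rightarrow> nat \<Rightarrow> nat set" where
  "passages D n = {i. 0 < i \<and> (\<exists>k. i + k < n \<and> D (i - 1) \<noteq> 0 \<and> (\<forall>l\<le>k. D (i + l) = 0) \<and>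
                                D (Suc (i + k)) = - D (i - 1))}"

primrec last_nonzero :: "(nat \<Rightarrow> int) \<Rightarrow> nat \<Rightarrow> int" where
  "last_nonzero D 0 = D 0"
| "last_nonzero D (Suc n) = (if D (Suc n) = 0 then last_nonzero D n else D (Suc n))"

lemma last_nonzero_position:
  "\<exists>m\<le>n. D m = last_nonzero D n \<and> (\<forall>j. m < j \<longrightarrow> j \<le> n \<longrightarrow> D j = 0)"
proof (induction n)
  case (Suc n)
  then obtain m where "m \<le> n" "D m = last_nonzero D n" "\<forall>j. m < j \<longrightarrow> j \<le> n \<longrightarrow> D j = 0" by blast
  then show ?case
    by (intro exI[of _ "if D (Suc n) = 0 then m else Suc n"]) (auto simp: le_Suc_eq)
qed auto

lemma last_nonzero_eq_0: "last_nonzero D n = 0 \<Longrightarrow> j \<le> n \<Longrightarrow> D j = 0"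
  by (induction n) (auto simp: le_Suc_eq split: if_splits)

text \<open>
  Only the final run of zeros can be completed by the next value, and it is completed by a value
  of the sign opposite to the last nonzero one. Since \<open>D\<close> moves by at most one, a change of sign
  always goes through \<open>0\<close> and from \<open>\<plusminus>1\<close> to \<open>\<mp>1\<close>.
\<close>

lemma card_passages_Suc:
  assumes step: "\<And>t. t \<le> n \<Longrightarrow> \<bar>D (Suc t) - D t\<bar> \<le> 1"
  shows "card (passages D (Suc n)) =
         card (passages D n) + (if last_nonzero D n * D (Suc n) < 0 then 1 else 0)"
proof -
  obtain m where m: "m \<le> n" "D m = last_nonzero D n" "\<forall>j. m < j \<longrightarrow> j \<le> n \<longrightarrow> D j = 0"
    using last_nonzero_position[of n D] by blast
  \<comment> \<open>the passages completed exactly at time \<open>n + 1\<close>\<close>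
  define Z where "Z = {i. 0 < i \<and> i \<le> n \<and> D (i - 1) \<noteq> 0 \<and> (\<forall>j. i \<le> j \<longrightarrow> j \<le> n \<longrightarrow> D j = 0) \<and>
    D (Suc n) = - D (i - 1)}"
  have split: "passages D (Suc n) = passages D n \<union> Z"
  proof (intro set_eqI iffI)
    fix i assume "i \<in> passages D (Suc n)"
    then obtain k where k: "0 < i" "i + k < Suc n" "D (i - 1) \<noteq> 0" "\<forall>l\<le>k. D (i + l) = 0"
      "D (Suc (i + k)) = - D (i - 1)" by (auto simp: passages_def)
    show "i \<in> passages D n \<union> Z"
    proof (cases "i + k < n")
      case True
      then show ?thesis using k by (auto simp: passages_def)
    next
      case False
      then have "i + k = n" using k by simp
      moreover have "D j = 0" if "i \<le> j" "j \<le> n" for j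
        using k(4) that \<open>i + k = n\<close> by (metis add_le_cancel_left le_Suc_ex)
      ultimately show ?thesis using k by (auto simp: Z_def)
    qed
  next
    fix i assume "i \<in> passages D n \<union> Z"
    then show "i \<in> passages D (Suc n)"
    proof
      assume "i \<in> Z"
      then show ?thesis
        unfolding passages_def Z_def by (auto intro!: exI[of _ "n - i"])
    next
      assume "i \<in> passages D n"
      then show ?thesis unfolding passages_def using less_SucI by blast
    qed
  qed
  have disjoint: "passages D n \<inter> Z = {}"
  proof -
    have False if "i \<in> passages D n" "i \<in> Z" for i
    proof -
      from that(1) obtain k where "i + k < n" "D (i - 1) \<noteq> 0" "D (Suc (i + k)) = - D (i - 1)"
        by (auto simp: passages_def)
      moreover have "D (Suc (i + k)) = 0"
        using that(2) \<open>i + k < n\<close> by (auto simp: Z_def)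
      ultimately show False by simp
    qed
    then show ?thesis by blast
  qed
  have fin: "finite (passages D n)" "finite Z"
    by (rule finite_subset[of _ "{..n}"]; force simp: passages_def Z_def)+
  have only_m: "i = Suc m" if "i \<in> Z" for i
  proof (rule ccontr)
    from that have i: "0 < i" "i \<le> n" "D (i - 1) \<noteq> 0" "\<And>j. i \<le> j \<Longrightarrow> j \<le> n \<Longrightarrow> D j = 0"
      unfolding Z_def by blast+
    assume "i \<noteq> Suc m"
    then consider "i - 1 < m" | "m < i - 1" using \<open>0 < i\<close> by linarith
    then show False
    proof cases
      case 1
      then have "D m = 0" using i m(1) by simp
      then have "last_nonzero D n = 0" using m(2) by simp
      then show False using last_nonzero_eq_0[of D n "i - 1"] i by simp
    next
      case 2
      then show False using m(3) i by simp
    qed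
  qed
  have Z: "Z = (if D m * D (Suc n) < 0 then {Suc m} else {})"
  proof (cases "D m * D (Suc n) < 0")
    case True
    have "m \<noteq> n"
    proof
      assume "m = n"
      then show False using True step[of n] by (simp add: mult_less_0_iff) linarith
    qed
    then have "m < n" using m(1) by simp
    then have "D (Suc m) = 0" "D n = 0" using m(3) by simp_all
    then have "\<bar>D m\<bar> \<le> 1" "\<bar>D (Suc n)\<bar> \<le> 1"
      using step[of m] step[of n] \<open>m < n\<close> by simp_all
    then have "D m \<noteq> 0" "D (Suc n) = - D m"
      using True unfolding mult_less_0_iff by linarith+
    then have "Suc m \<in> Z"
      using m(3) \<open>m < n\<close> unfolding Z_def by simp
    then have "Z = {Suc m}" using only_m by blast
    then show ?thesis using True by simp
  next
    case False
    have "i \<notin> Z" for i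
    proof
      assume "i \<in> Z"
      then have "D m \<noteq> 0" "D (Suc n) = - D m" using only_m[of i] unfolding Z_def by simp_all
      then show False using False by (simp add: zero_less_mult_iff)
    qed
    then have "Z = {}" by blast
    then show ?thesis using False by simp
  qed
  show ?thesis
    unfolding split m(2)[symmetric] using fin disjoint Z by (simp add: card_Un_disjoint)
qed

lemma passages_0: "passages D 0 = {}"
  by (auto simp: passages_def)

lemma card_passages_negative_start:
  assumes "D 0 < 0" and "\<And>t. t < n \<Longrightarrow> \<bar>D (Suc t) - D t\<bar> \<le> 1"
  shows "card (passages D n) = changes D n \<and> last_nonzero D n \<noteq> 0 \<and>
         (0 < last_nonzero D n \<longleftrightarrow> odd (changes D n))"
  using assms(2)
proof (induction n)
  case (Suc n)
  then have "card (passages D n) = changes D n \<and> last_nonzero D n \<noteq> 0 \<and>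
         (0 < last_nonzero D n \<longleftrightarrow> odd (changes D n))" by simp
  then show ?case
    using card_passages_Suc[of n D] Suc.prems
    by (auto simp: bump_def mult_less_0_iff)
qed (use assms in \<open>simp add: passages_0\<close>)

text \<open>
  If the gap starts at \<open>0\<close>, the sign assumed at the start is wrong for exactly one of \<open>D\<close> and \<open>- D\<close>,
  as soon as a nonzero value occurs; that one counts one change too many. The parities are
  carried along to make the induction work.
\<close>

lemma card_passages_zero_start:
  assumes "D 0 = 0" and "\<And>t. t < n \<Longrightarrow> \<bar>D (Suc t) - D t\<bar> \<le> 1"
  defines "D' \<equiv> \<lambda>t. - D t"
  shows "if last_nonzero D n = 0 then card (passages D n) = 0 \<and> changes D n = 0 \<and> changes D' n = 0
         else (0 < last_nonzero D n \<longleftrightarrow> odd (changes D n)) \<and>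
              (0 < last_nonzero D n \<longleftrightarrow> even (changes D' n)) \<and>
              (changes D n = card (passages D n) \<and> changes D' n = Suc (card (passages D n)) \<or>
               changes D' n = card (passages D n) \<and> changes D n = Suc (card (passages D n)))"
  using assms(2)
proof (induction n)
  case (Suc n)
  have D': "D' (Suc n) = - D (Suc n)" by (simp add: D'_def)
  have "card (passages D (Suc n)) =
         card (passages D n) + (if last_nonzero D n * D (Suc n) < 0 then 1 else 0)"
    using Suc.prems by (intro card_passages_Suc) auto
  moreover have "changes D (Suc n) = bump (D (Suc n)) (changes D n)"
    "changes D' (Suc n) = bump (- D (Suc n)) (changes D' n)" by (simp_all add: D'_def)
  moreover have "last_nonzero D (Suc n) = (if D (Suc n) = 0 then last_nonzero D n else D (Suc n))"
    by simp
  moreover have "if last_nonzero D n = 0 then card (passages D n) = 0 \<and> changes D n = 0 \<and> changes D' n = 0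
         else (0 < last_nonzero D n \<longleftrightarrow> odd (changes D n)) \<and>
              (0 < last_nonzero D n \<longleftrightarrow> even (changes D' n)) \<and>
              (changes D n = card (passages D n) \<and> changes D' n = Suc (card (passages D n)) \<or>
               changes D' n = card (passages D n) \<and> changes D n = Suc (card (passages D n)))"
    using Suc.prems by (intro Suc.IH) simp
  ultimately show ?case
    by (auto simp: bump_def mult_less_0_iff split: if_splits)
qed (use assms in \<open>simp add: passages_0\<close>)

lemma east_take_Suc: "i < length w \<Longrightarrow> east (take (Suc i) w) = east (take i w) + dx (w ! i)"
  by (simp add: take_Suc_conv_app_nth)

lemma count_N: "int (count_list w N) = int (length w) - east w"
proof (induction w)
  case (Cons s w)
  then show ?case by (cases s) (auto simp: east_def)
qed (simp add: east_def)

lemma vertex_Path: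
  "i \<le> length w \<Longrightarrow> vertex (Path A w) i = (fst A + east (take i w), snd A + (int i - east (take i w)))"
  by (simp add: vertex_def count_N) (simp add: east_def)

lemma gap_Suc:
  "t < length u \<Longrightarrow> t < length v \<Longrightarrow> gap d u v (Suc t) = gap d u v t + dx (u ! t) - dx (v ! t)"
  by (simp add: gap_def east_take_Suc)

lemma dx_eq_iff: "dx s = dx t \<longleftrightarrow> s = t"
  by (cases s; cases t) auto

lemma dx_diff_eqD: "dx a - dx b = dx a' - dx b' \<Longrightarrow> a \<noteq> b \<Longrightarrow> a = a' \<and> b = b'"
  by (cases a; cases b; cases a'; cases b') auto

text \<open>
  The steps of the two words differ exactly where the gap changes, and their difference then
  determines both steps. So the conditions on the steps in the definition of a crossing are
  conditions on the gap.
\<close>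

lemma crossing_iff_gap:
  fixes d :: int and u v :: "step list"
  assumes "0 < i" and "i + k < length u" and "i + k < length v"
  defines "D \<equiv> gap d u v"
  shows "D i = 0 \<and> u ! (i - 1) \<noteq> v ! (i - 1) \<and> (\<forall>l<k. u ! (i + l) = v ! (i + l)) \<and>
         u ! (i + k) \<noteq> v ! (i + k) \<and> u ! (i + k) = u ! (i - 1) \<and> v ! (i + k) = v ! (i - 1) \<longleftrightarrow>
         D (i - 1) \<noteq> 0 \<and> (\<forall>l\<le>k. D (i + l) = 0) \<and> D (Suc (i + k)) = - D (i - 1)" (is "?L \<longleftrightarrow> ?R")
proof -
  have step: "D (Suc t) = D t + dx (u ! t) - dx (v ! t)" if "t \<le> i + k" for t
    using that assms by (simp add: gap_Suc)
  have arrive: "D i = D (i - 1) + dx (u ! (i - 1)) - dx (v ! (i - 1))"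
    using step[of "i - 1"] assms(1) by simp
  show ?thesis
  proof
    assume L: ?L
    have "D (i + l) = 0" if "l \<le> k" for l
      using that
    proof (induction l)
      case (Suc l)
      then show ?case using step[of "i + l"] L by simp
    qed (use L in simp)
    moreover from this[of k] have "D (Suc (i + k)) = - D (i - 1)"
      using step[of "i + k"] arrive L by simp
    moreover have "D (i - 1) \<noteq> 0"
      using arrive L dx_eq_iff by auto
    ultimately show ?R by blast
  next
    assume R: ?R
    then have "D i = 0" by (metis add_0_right le0)
    have "u ! (i + l) = v ! (i + l)" if "l < k" for l
    proof -
      have "D (i + l) = 0" "D (Suc (i + l)) = 0"
        using R that by (auto simp flip: add_Suc_right)
      then show ?thesis using step[of "i + l"] that by (simp flip: dx_eq_iff)
    qed
    moreover have "dx (u ! (i + k)) - dx (v ! (i + k)) = dx (u ! (i - 1)) - dx (v ! (i - 1))"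
    proof -
      have "D (i + k) = 0" "D (Suc (i + k)) = - D (i - 1)" using R by auto
      then show ?thesis using step[of "i + k"] arrive \<open>D i = 0\<close> by linarith
    qed
    moreover have "u ! (i - 1) \<noteq> v ! (i - 1)"
      using arrive R \<open>D i = 0\<close> by auto
    moreover from calculation have "u ! (i + k) \<noteq> v ! (i + k)"
      using dx_eq_iff[of "u ! (i - 1)" "v ! (i - 1)"] by auto
    ultimately show ?L using dx_diff_eqD \<open>D i = 0\<close> by metis
  qed
qed

text \<open>
  On a common antidiagonal the position of a vertex on a path is determined by the sum of its
  coordinates, hence a common vertex has the same position on both paths.
\<close>

lemma num_crossings_passages:
  assumes "fst A' - fst A = d" and "snd A - snd A' = d"
  shows "\<chi> (Path A u) (Path A' v) = card (passages (gap d u v) (min (length u) (length v)))"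
proof -
  let ?P = "Path A u" and ?Q = "Path A' v" and ?D = "gap d u v" and ?m = "min (length u) (length v)"
  have meet: "vertex ?P i = vertex ?Q j \<longleftrightarrow> i = j \<and> ?D i = 0" if "i \<le> length u" "j \<le> length v" for i j
  proof
    assume "vertex ?P i = vertex ?Q j"
    then have "fst A + east (take i u) = fst A' + east (take j v)"
      "snd A + (int i - east (take i u)) = snd A' + (int j - east (take j v))"
      using that by (simp_all add: vertex_Path)
    moreover from this have "i = j" using assms by linarith
    ultimately show "i = j \<and> ?D i = 0" using assms by (simp add: gap_def)
  next
    assume "i = j \<and> ?D i = 0"
    then show "vertex ?P i = vertex ?Q j" using that assms by (auto simp: vertex_Path gap_def)
  qed
  have "crossing ?P ?Q C \<longleftrightarrow> (\<exists>i\<in>passages ?D ?m. C = vertex ?P i)" for C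
  proof
    assume "crossing ?P ?Q C"
    then obtain i j k where ij: "0 < i" "i \<le> length u" "vertex ?P i = C" "0 < j" "j \<le> length v" "vertex ?Q j = C"
       "u ! (i - 1) \<noteq> v ! (j - 1)" "i + k < length u" "j + k < length v"
       "\<forall>l<k. u ! (i + l) = v ! (j + l)" "u ! (i + k) \<noteq> v ! (j + k)"
       "u ! (i + k) = u ! (i - 1)" "v ! (j + k) = v ! (j - 1)"
      by (auto simp: crossing_def)
    moreover have "j = i" "?D i = 0" using ij meet[of i j] by auto
    ultimately have "?D (i - 1) \<noteq> 0 \<and> (\<forall>l\<le>k. ?D (i + l) = 0) \<and> ?D (Suc (i + k)) = - ?D (i - 1)"
      by (subst crossing_iff_gap[symmetric]) auto
    then have "i \<in> passages ?D ?m"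
      using ij \<open>j = i\<close> by (auto simp: passages_def)
    then show "\<exists>i\<in>passages ?D ?m. C = vertex ?P i" using ij by blast
  next
    assume "\<exists>i\<in>passages ?D ?m. C = vertex ?P i"
    then obtain i k where i: "0 < i" "i + k < length u" "i + k < length v" "C = vertex ?P i"
      and *: "?D (i - 1) \<noteq> 0 \<and> (\<forall>l\<le>k. ?D (i + l) = 0) \<and> ?D (Suc (i + k)) = - ?D (i - 1)"
      by (auto simp: passages_def)
    have L: "?D i = 0 \<and> u ! (i - 1) \<noteq> v ! (i - 1) \<and> (\<forall>l<k. u ! (i + l) = v ! (i + l)) \<and>
         u ! (i + k) \<noteq> v ! (i + k) \<and> u ! (i + k) = u ! (i - 1) \<and> v ! (i + k) = v ! (i - 1)"
      using crossing_iff_gap[OF i(1-3)] * by blast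
    moreover have "vertex ?Q i = C" using meet[of i i] L i by auto
    ultimately show "crossing ?P ?Q C"
      unfolding crossing_def using i by (intro exI[of _ i] exI[of _ k]) auto
  qed
  then have "{C. crossing ?P ?Q C} = vertex ?P ` passages ?D ?m" by blast
  moreover have "inj_on (vertex ?P) (passages ?D ?m)"
    by (auto simp: inj_on_def vertex_Path passages_def)
  ultimately show ?thesis
    by (simp add: num_crossings_def card_image)
qed


lemma abs_gap_step: "t < min (length u) (length v) \<Longrightarrow> \<bar>gap d u v (Suc t) - gap d u v t\<bar> \<le> 1"
  by (simp add: gap_Suc dx_def)

lemma gap_0 [simp]: "gap d u v 0 = - d"
  by (simp add: gap_def)

lemma gap_swap: "gap d u v t = - gap (- d) v u t"
  by (simp add: gap_def)

lemma num_crossings_eq_cross: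
  assumes "0 < d" and "fst A' - fst A = d" and "snd A - snd A' = d"
  shows "\<chi> (Path A u) (Path A' v) = cross d u v"
  unfolding num_crossings_passages[OF assms(2,3)] cross_def
  by (rule card_passages_negative_start[THEN conjunct1]) (simp_all add: abs_gap_step assms(1))

lemma num_crossings_commute: "\<chi> P Q = \<chi> Q P"
proof -
  have "crossing P Q C \<Longrightarrow> crossing Q P C" for P Q C
    unfolding crossing_def by metis
  then have "{C. crossing P Q C} = {C. crossing Q P C}" by blast
  then show ?thesis by (simp add: num_crossings_def)
qed

text \<open>Exchanging the two paths negates the gap.\<close>

lemma cross_common_start:
  fixes A :: point and u v :: "step list"
  defines "c \<equiv> \<chi> (Path A u) (Path A v)"
  shows "(c = 0 \<and> cross 0 u v = 0 \<and> cross 0 v u = 0) \<or>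
         (cross 0 u v = c \<and> cross 0 v u = Suc c) \<or> (cross 0 v u = c \<and> cross 0 u v = Suc c)"
proof -
  let ?m = "min (length u) (length v)"
  have "c = card (passages (gap 0 u v) ?m)"
    unfolding c_def by (rule num_crossings_passages) simp_all
  moreover have "cross 0 u v = changes (gap 0 u v) ?m"
    by (simp add: cross_def)
  moreover have "gap 0 v u = (\<lambda>t. - gap 0 u v t)"
    by (auto simp: gap_def)
  then have "cross 0 v u = changes (\<lambda>t. - gap 0 u v t) ?m"
    by (simp add: cross_def min.commute)
  ultimately show ?thesis
    using card_passages_zero_start[of "gap 0 u v" ?m] abs_gap_step[of _ u v 0]
    by (auto split: if_splits)
qed

section \<open>From words to paths\<close>

definition walks :: "nat \<Rightarrow> int \<Rightarrow> step list set" where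
  "walks n k = {w. length w = n \<and> east w = k}"

lemma sum_walks: "(\<Sum>w\<in>walks n k. F w) = (\<Sum>s\<in>{E, N}. \<Sum>w\<in>words n s k. F w)"
proof -
  have "walks n k = words n E k \<union> words n N k"
    using step.exhaust by (auto simp: walks_def words_def)
  moreover have "words n E k \<inter> words n N k = {}"
    by (auto simp: words_def)
  ultimately show ?thesis by (simp add: sum.union_disjoint)
qed

lemma sum_cross_ge:
  assumes g: "generic q" and d: "0 \<le> d"
    and sides: "side r (i - j - d)" "side r (i - j - d - (int p - int n))"
  shows "(\<Sum>u\<in>walks p i. \<Sum>v\<in>walks n j. if r \<le> cross d u v then q ^ word_maj u * q ^ word_maj v else 0)
    = q powi (shift r d * (shift r d + d)) * qbinomial q (int p) (i + shift r d)
        * qbinomial q (int n) (j - shift r d)"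
proof -
  have "(\<Sum>u\<in>walks p i. \<Sum>v\<in>walks n j. if r \<le> cross d u v then q ^ word_maj u * q ^ word_maj v else 0)
    = (\<Sum>a\<in>{E, N}. \<Sum>b\<in>{E, N}. pair_gf q r d p n a b i j)"
    unfolding sum_walks pair_gf_def by (rule sum.cong[OF refl], rule sum.swap)
  also have "\<dots> = (\<Sum>a\<in>{E, N}. \<Sum>b\<in>{E, N}. shifted_gf q d (shift r d) p n a b i j)"
    by (simp only: pair_gf_formula[OF g d sides])
  also have "\<dots> = q powi (shift r d * (shift r d + d)) * (\<Sum>a\<in>{E, N}. maj_gf q p a (i + shift r d))
        * (\<Sum>b\<in>{E, N}. maj_gf q n b (j - shift r d))"
    by (simp add: shifted_gf_def algebra_simps)
  finally show ?thesis by (simp only: maj_gf_total[OF g])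
qed

lemma maj_Path: "maj (Path A w) = word_maj w"
  by (simp add: maj_def word_maj_def valleys_def)

definition distance :: "point \<Rightarrow> point \<Rightarrow> int" where
  "distance A B = fst B - fst A + snd B - snd A"

lemma mem_paths_iff:
  "Path C w \<in> paths A B \<longleftrightarrow> C = A \<and> int (length w) = distance A B \<and> east w = fst B - fst A"
  by (auto simp: paths_def vertex_Path distance_def prod_eq_iff)

lemma paths_eq_walks:
  assumes "int n = distance A B"
  shows "paths A B = Path A ` walks n (fst B - fst A)"
proof (intro set_eqI)
  fix P show "P \<in> paths A B \<longleftrightarrow> P \<in> Path A ` walks n (fst B - fst A)"
    by (cases P) (use assms in \<open>auto simp: mem_paths_iff walks_def\<close>)
qed

lemma paths_empty: "distance A B < 0 \<Longrightarrow> paths A B = {}"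
proof -
  assume "distance A B < 0"
  then have "P \<notin> paths A B" for P by (cases P) (simp add: mem_paths_iff)
  then show ?thesis by blast
qed

lemma H_ge_as_sum:
  "H_ge q r A B A' B' =
    (\<Sum>P\<in>paths A B. \<Sum>Q\<in>paths A' B'. if r \<le> \<chi> P Q then q ^ maj P * q ^ maj Q else 0)"
proof -
  have "path_pairs_ge r A B A' B' = {z \<in> paths A B \<times> paths A' B'. r \<le> \<chi> (fst z) (snd z)}"
    by (auto simp: path_pairs_ge_def)
  then have "H_ge q r A B A' B' =
    (\<Sum>z\<in>paths A B \<times> paths A' B'. if r \<le> \<chi> (fst z) (snd z) then q ^ maj (fst z) * q ^ maj (snd z) else 0)"
    unfolding H_ge_def
    by (simp add: sum.inter_filter finite_paths power_add case_prod_beta cong: if_cong)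
  then show ?thesis by (simp add: sum.cartesian_product case_prod_beta)
qed

lemma H_ge_walks:
  assumes "int p = distance A B" and "int n = distance A' B'"
  shows "H_ge q r A B A' B' =
    (\<Sum>u\<in>walks p (fst B - fst A). \<Sum>v\<in>walks n (fst B' - fst A').
       if r \<le> \<chi> (Path A u) (Path A' v) then q ^ word_maj u * q ^ word_maj v else 0)"
proof -
  have inj: "inj_on (Path C) S" for C S by (auto simp: inj_on_def)
  show ?thesis
    unfolding H_ge_as_sum paths_eq_walks[OF assms(1)] paths_eq_walks[OF assms(2)]
    by (simp add: sum.reindex[OF inj] maj_Path cong: if_cong)
qed

lemma qbinomial_negative: "n < 0 \<Longrightarrow> qbinomial q n k = 0"
  by (simp add: qbinomial_def)

text \<open>
  The hypothesis \<open>counts\<close> is where the configurations of endpoints differ: it lets \<open>\<chi>\<close> be replaced by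
  the counter. If a path would need a negative number of steps, both sides are \<open>0\<close>.
\<close>

lemma H_ge_product:
  assumes g: "generic q" and d: "0 \<le> d" "fst A' - fst A = d" "snd A - snd A' = d"
    and counts: "\<And>u v. Path A u \<in> paths A B \<Longrightarrow> Path A' v \<in> paths A' B' \<Longrightarrow>
                   r \<le> \<chi> (Path A u) (Path A' v) \<longleftrightarrow> r \<le> cross d u v"
    and sides: "side r (fst B - fst B')" "side r (snd B' - snd B)"
  shows "H_ge q r A B A' B' = q powi (shift r d * (shift r d + d))
    * qbinomial q (distance A B) (fst B - fst A + shift r d)
    * qbinomial q (distance A' B') (fst B' - fst A' - shift r d)"
proof (cases "0 \<le> distance A B \<and> 0 \<le> distance A' B'")
  case True
  then obtain p n where pn: "int p = distance A B" "int n = distance A' B'"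
    by (metis nonneg_int_cases)
  have "H_ge q r A B A' B' = (\<Sum>u\<in>walks p (fst B - fst A). \<Sum>v\<in>walks n (fst B' - fst A').
       if r \<le> cross d u v then q ^ word_maj u * q ^ word_maj v else 0)"
    unfolding H_ge_walks[OF pn]
    by (intro sum.cong refl) (use pn in \<open>simp add: counts mem_paths_iff walks_def\<close>)
  moreover have "(fst B - fst A) - (fst B' - fst A') - d = fst B - fst B'"
    "(fst B - fst A) - (fst B' - fst A') - d - (int p - int n) = snd B' - snd B"
    using d pn by (auto simp: distance_def)
  then have "side r ((fst B - fst A) - (fst B' - fst A') - d)"
    "side r ((fst B - fst A) - (fst B' - fst A') - d - (int p - int n))"
    using sides by (simp_all only:)
  from sum_cross_ge[OF g d(1) this] have "(\<Sum>u\<in>walks p (fst B - fst A). \<Sum>v\<in>walks n (fst B' - fst A').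
       if r \<le> cross d u v then q ^ word_maj u * q ^ word_maj v else 0)
     = q powi (shift r d * (shift r d + d)) * qbinomial q (distance A B) (fst B - fst A + shift r d)
       * qbinomial q (distance A' B') (fst B' - fst A' - shift r d)"
    by (simp only: pn)
  ultimately show ?thesis by (rule trans)
next
  case False
  then have "paths A B = {} \<or> paths A' B' = {}"
    using paths_empty by (meson not_le)
  then have "H_ge q r A B A' B' = 0"
    by (auto simp: H_ge_as_sum)
  then show ?thesis using False by (auto simp: qbinomial_negative)
qed

lemma f_prod_distance:
  "f_prod q r A A' F F' = q powi (int r * (int r + fst A' - fst A))
     * qbinomial q (distance A F) (fst F - fst A + int r)
     * qbinomial q (distance A' F') (fst F' - fst A' - int r)"
  by (cases A; cases A'; cases F; cases F') (simp add: distance_def)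

lemma H_ge_even:
  assumes g: "generic q" and d: "0 \<le> d" "fst A' - fst A = d" "snd A - snd A' = d"
    and counts: "\<And>u v. Path A u \<in> paths A B \<Longrightarrow> Path A' v \<in> paths A' B' \<Longrightarrow>
                   r \<le> \<chi> (Path A u) (Path A' v) \<longleftrightarrow> r \<le> cross d u v"
    and "even r" "fst B' \<le> fst B" "snd B \<le> snd B'"
  shows "H_ge q r A B A' B' = f_prod q r A A' B B'"
proof -
  have "H_ge q r A B A' B' = q powi (shift r d * (shift r d + d))
    * qbinomial q (distance A B) (fst B - fst A + shift r d)
    * qbinomial q (distance A' B') (fst B' - fst A' - shift r d)"
    by (rule H_ge_product[OF g d]) (use assms in \<open>simp_all add: side_def\<close>)
  moreover have "int r + fst A' - fst A = int r + d" using d by simp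
  ultimately show ?thesis
    using \<open>even r\<close> by (simp only: shift_def f_prod_distance if_True)
qed

text \<open>
  For odd \<open>r\<close> the shift is \<open>- r - d\<close>, which moves each starting point beyond the other one. So the two
  factors change places: the first path, which ends to the left, contributes the second one.
\<close>

lemma H_ge_odd:
  assumes g: "generic q" and d: "0 \<le> d" "fst A' - fst A = d" "snd A - snd A' = d"
    and counts: "\<And>u v. Path A u \<in> paths A B \<Longrightarrow> Path A' v \<in> paths A' B' \<Longrightarrow>
                   r \<le> \<chi> (Path A u) (Path A' v) \<longleftrightarrow> r \<le> cross d u v"
    and "odd r" "fst B \<le> fst B'" "snd B' \<le> snd B"
  shows "H_ge q r A B A' B' = f_prod q r A A' B' B"
proof -
  have "shift r d = - int r - d" using \<open>odd r\<close> by (simp add: shift_def)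
  moreover have "(- int r - d) * (- int r - d + d) = int r * (int r + fst A' - fst A)"
    using d by (simp add: algebra_simps)
  moreover have "distance A' B' = distance A B'" "distance A B = distance A' B"
    using d by (auto simp: distance_def)
  moreover have "fst B - fst A + (- int r - d) = fst B - fst A' - int r"
    "fst B' - fst A' - (- int r - d) = fst B' - fst A + int r" using d by auto
  moreover have "H_ge q r A B A' B' = q powi (shift r d * (shift r d + d))
    * qbinomial q (distance A B) (fst B - fst A + shift r d)
    * qbinomial q (distance A' B') (fst B' - fst A' - shift r d)"
    by (rule H_ge_product[OF g d]) (use assms in \<open>simp_all add: side_def\<close>)
  ultimately show ?thesis
    by (simp only: f_prod_distance mult.commute mult.left_commute)
qed

text \<open>
  The longer path has not yet reached its endpoint when the shorter one ends, but it cannot be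
  beyond it. Comparing ordinates if the second path is longer, and abscissas otherwise, shows that
  the order of the endpoints is already visible at that time.
\<close>

lemma gap_end_negative:
  assumes "Path A u \<in> paths A B" and "Path A' v \<in> paths A' B'" and "B \<prec> B'"
    and d: "fst A' - fst A = d" "snd A - snd A' = d"
  shows "gap d u v (min (length u) (length v)) < 0"
proof -
  have east_take: "east (take t w) \<le> east w" "int t - east (take t w) \<le> int (length w) - east w"
    if "t \<le> length w" for t w
  proof -
    have "count_list w s = count_list (take t w) s + count_list (drop t w) s" for s
      by (metis append_take_drop_id count_list_append)
    then show "east (take t w) \<le> east w" "int t - east (take t w) \<le> int (length w) - east w"
      using count_N[of w] count_N[of "take t w"] that by (simp_all add: east_def)
  qed
  have *: "int (length u) = distance A B" "east u = fst B - fst A"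
    "int (length v) = distance A' B'" "east v = fst B' - fst A'" "fst B < fst B'" "snd B' < snd B"
    using assms(1-3) by (simp_all add: mem_paths_iff prec_def)
  show ?thesis
  proof (cases "length u \<le> length v")
    case True
    then show ?thesis
      using east_take(2)[OF True] * d by (simp add: gap_def distance_def min_def)
  next
    case False
    then show ?thesis
      using east_take(1)[of "length v" u] * d by (simp add: gap_def distance_def min_def)
  qed
qed

lemma gap_end_positive:
  assumes "Path A u \<in> paths A B" and "Path A' v \<in> paths A' B'" and "B' \<prec> B"
    and d: "fst A' - fst A = d" "snd A - snd A' = d"
  shows "0 < gap d u v (min (length u) (length v))"
  using gap_end_negative[OF assms(2,1,3), of "- d"] d
  by (simp add: gap_swap[of d u v] min.commute)

lemma H_ge_cong:
  assumes "\<And>u v. Path A u \<in> paths A B \<Longrightarrow> Path A' v \<in> paths A' B' \<Longrightarrow>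
             r \<le> \<chi> (Path A u) (Path A' v) \<longleftrightarrow> s \<le> \<chi> (Path A u) (Path A' v)"
  shows "H_ge q r A B A' B' = H_ge q s A B A' B'"
proof -
  have "r \<le> \<chi> P Q \<longleftrightarrow> s \<le> \<chi> P Q" if "P \<in> paths A B" "Q \<in> paths A' B'" for P Q
  proof -
    have "P = Path A (steps P)" "Q = Path A' (steps Q)"
      using that by (metis mem_paths_iff path.exhaust_sel)+
    then show ?thesis using assms that by metis
  qed
  then show ?thesis unfolding H_ge_as_sum by (intro sum.cong refl) auto
qed

lemma H_ge_swap: "H_ge q r A B A' B' = H_ge q r A' B' A B"
  unfolding H_ge_as_sum by (subst sum.swap) (simp add: num_crossings_commute mult.commute cong: if_cong)

section \<open>The five configurations of endpoints\<close>

lemma even_le_iff: "even (r::nat) \<Longrightarrow> odd c \<Longrightarrow> Suc r \<le> c \<longleftrightarrow> r \<le> c"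
  by (auto simp: Suc_le_eq le_less)

text \<open>The first path starts on the left and ends on the right, so the number of crossings is odd.\<close>

lemma H_ge_endpoints_SE_NW:
  assumes g: "generic q" and "A1 \<prec> A2" and "B1 \<prec> B2" and diag: "fst A1 + snd A1 = fst A2 + snd A2"
  shows "H_ge q (2 * m + 1) A1 B2 A2 B1 = H_ge q (2 * m) A1 B2 A2 B1"
    and "H_ge q (2 * m) A1 B2 A2 B1 = f_prod q (2 * m) A1 A2 B2 B1"
proof -
  define d where "d = fst A2 - fst A1"
  have d: "0 < d" "fst A2 - fst A1 = d" "snd A1 - snd A2 = d"
    using \<open>A1 \<prec> A2\<close> diag by (auto simp: d_def prec_def)
  show "H_ge q (2 * m + 1) A1 B2 A2 B1 = H_ge q (2 * m) A1 B2 A2 B1"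
  proof (rule H_ge_cong)
    fix u v assume uv: "Path A1 u \<in> paths A1 B2" "Path A2 v \<in> paths A2 B1"
    have "odd (\<chi> (Path A1 u) (Path A2 v))"
      unfolding num_crossings_eq_cross[OF d]
      using cross_parity(1)[OF _ refl, of d u v] gap_end_positive[OF uv \<open>B1 \<prec> B2\<close> d(2,3)] d by simp
    then show "2 * m + 1 \<le> \<chi> (Path A1 u) (Path A2 v) \<longleftrightarrow> 2 * m \<le> \<chi> (Path A1 u) (Path A2 v)"
      using even_le_iff[of "2 * m"] by simp
  qed
  show "H_ge q (2 * m) A1 B2 A2 B1 = f_prod q (2 * m) A1 A2 B2 B1"
    using \<open>B1 \<prec> B2\<close> d
    by (intro H_ge_even[OF g, of d]) (simp_all add: num_crossings_eq_cross[OF d] prec_def)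
qed

text \<open>The first path stays on the left in the end, so the number of crossings is even.\<close>

lemma H_ge_endpoints_NW_SE:
  assumes g: "generic q" and "A1 \<prec> A2" and "B1 \<prec> B2" and diag: "fst A1 + snd A1 = fst A2 + snd A2"
    and "1 \<le> m"
  shows "H_ge q (2 * m) A1 B1 A2 B2 = H_ge q (2 * m - 1) A1 B1 A2 B2"
    and "H_ge q (2 * m - 1) A1 B1 A2 B2 = f_prod q (2 * m - 1) A1 A2 B2 B1"
proof -
  define d where "d = fst A2 - fst A1"
  have d: "0 < d" "fst A2 - fst A1 = d" "snd A1 - snd A2 = d"
    using \<open>A1 \<prec> A2\<close> diag by (auto simp: d_def prec_def)
  show "H_ge q (2 * m) A1 B1 A2 B2 = H_ge q (2 * m - 1) A1 B1 A2 B2"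
  proof (rule H_ge_cong)
    fix u v assume uv: "Path A1 u \<in> paths A1 B1" "Path A2 v \<in> paths A2 B2"
    have "even (\<chi> (Path A1 u) (Path A2 v))"
      unfolding num_crossings_eq_cross[OF d]
      using cross_parity(2)[OF _ refl, of d u v] gap_end_negative[OF uv \<open>B1 \<prec> B2\<close> d(2,3)] d by simp
    then show "2 * m \<le> \<chi> (Path A1 u) (Path A2 v) \<longleftrightarrow> 2 * m - 1 \<le> \<chi> (Path A1 u) (Path A2 v)"
      using \<open>1 \<le> m\<close> by (auto elim!: evenE)
  qed
  show "H_ge q (2 * m - 1) A1 B1 A2 B2 = f_prod q (2 * m - 1) A1 A2 B2 B1"
    using \<open>B1 \<prec> B2\<close> \<open>1 \<le> m\<close> d
    by (intro H_ge_odd[OF g, of d]) (simp_all add: num_crossings_eq_cross[OF d] prec_def)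
qed

text \<open>
  The paths have equally many steps and the final gap is \<open>0\<close>, which lies on the side of every \<open>r\<close>; so there is one
  formula for both parities.
\<close>

lemma H_ge_common_end:
  assumes g: "generic q" and "A1 \<prec> A2" and diag: "fst A1 + snd A1 = fst A2 + snd A2"
  shows "H_ge q r A1 B A2 B = f_prod q r A1 A2 B B"
proof -
  define d where "d = fst A2 - fst A1"
  have d: "0 < d" "fst A2 - fst A1 = d" "snd A1 - snd A2 = d"
    using \<open>A1 \<prec> A2\<close> diag by (auto simp: d_def prec_def)
  show ?thesis
  proof (cases "even r")
    case True
    then show ?thesis
      using d by (intro H_ge_even[OF g, of d]) (simp_all add: num_crossings_eq_cross[OF d])
  next
    case False
    then show ?thesis
      using d by (intro H_ge_odd[OF g, of d]) (simp_all add: num_crossings_eq_cross[OF d])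
  qed
qed

text \<open>
  The counter may exceed \<open>\<chi>\<close> by one, but its parity is known from the endpoints. It differs from that
  of \<open>r\<close> if the path ending on the right is taken first for even \<open>r\<close> and second for odd \<open>r\<close>; then
  the counter is never \<open>r\<close>, and \<open>\<chi>\<close> reaches \<open>r\<close> whenever the counter does.
\<close>

lemma H_ge_common_start:
  assumes g: "generic q" and "B1 \<prec> B2"
  shows "H_ge q r A B1 A B2 = f_prod q r A A B2 B1"
proof (cases "even r")
  case True
  have "H_ge q r A B2 A B1 = f_prod q r A A B2 B1"
  proof (rule H_ge_even[OF g, of 0])
    fix u v assume uv: "Path A u \<in> paths A B2" "Path A v \<in> paths A B1"
    have "odd (cross 0 u v)"
      using cross_parity(1)[OF _ refl, of 0 u v] gap_end_positive[OF uv \<open>B1 \<prec> B2\<close>, of 0] by simp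
    then show "r \<le> \<chi> (Path A u) (Path A v) \<longleftrightarrow> r \<le> cross 0 u v"
      using cross_common_start[of A u v] True by (auto simp: le_Suc_eq)
  qed (use True \<open>B1 \<prec> B2\<close> in \<open>auto simp: prec_def\<close>)
  then show ?thesis by (subst H_ge_swap)
next
  case False
  show ?thesis
  proof (rule H_ge_odd[OF g, of 0])
    fix u v assume uv: "Path A u \<in> paths A B1" "Path A v \<in> paths A B2"
    have "even (cross 0 u v)"
      using cross_parity(2)[OF _ refl, of 0 u v] gap_end_negative[OF uv \<open>B1 \<prec> B2\<close>, of 0] by simp
    then show "r \<le> \<chi> (Path A u) (Path A v) \<longleftrightarrow> r \<le> cross 0 u v"
      using cross_common_start[of A u v] False by (auto simp: le_Suc_eq)
  qed (use False \<open>B1 \<prec> B2\<close> in \<open>auto simp: prec_def\<close>)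
qed

lemma H_ge_same_ends_0:
  assumes "generic q"
  shows "H_ge q 0 A B A B = f_prod q 0 A A B B"
  by (rule H_ge_even[OF assms, of 0]) auto

text \<open>
  For each pair, the thresholds \<open>r\<close> and \<open>r + 1\<close> for \<open>\<chi>\<close> are reached as often as the threshold
  \<open>r + 1\<close> by the two counters, which are \<open>\<chi>\<close> and \<open>\<chi> + 1\<close> unless all three vanish. Both counters have the generating function
  \<open>f_prod\<close>, since exchanging the paths preserves the weight.
\<close>

lemma H_ge_same_ends_add:
  assumes g: "generic q" and "1 \<le> r"
  shows "H_ge q r A B A B + H_ge q (Suc r) A B A B = 2 * f_prod q (Suc r) A A B B"
proof (cases "0 \<le> distance A B")
  case True
  then obtain n where n: "int n = distance A B" by (metis nonneg_int_cases)
  let ?W = "walks n (fst B - fst A)"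
  let ?w = "\<lambda>u v. q ^ word_maj u * q ^ word_maj v"
  have f: "(\<Sum>u\<in>?W. \<Sum>v\<in>?W. if Suc r \<le> cross 0 u v then ?w u v else 0) = f_prod q (Suc r) A A B B"
  proof (cases "odd r")
    case True
    then show ?thesis
      by (subst sum_cross_ge[OF g]) (simp_all add: side_def shift_def f_prod_distance n)
  next
    case False
    then show ?thesis
      by (subst sum_cross_ge[OF g])
        (simp_all add: side_def shift_def f_prod_distance n algebra_simps)
  qed
  have f': "(\<Sum>u\<in>?W. \<Sum>v\<in>?W. if Suc r \<le> cross 0 v u then ?w u v else 0) = f_prod q (Suc r) A A B B"
    unfolding f[symmetric] by (subst sum.swap) (simp add: mult.commute cong: if_cong)
  have "(if r \<le> \<chi> (Path A u) (Path A v) then ?w u v else 0) + (if Suc r \<le> \<chi> (Path A u) (Path A v) then ?w u v else 0)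
     = (if Suc r \<le> cross 0 u v then ?w u v else 0) + (if Suc r \<le> cross 0 v u then ?w u v else 0)" for u v
    using cross_common_start[of A u v] \<open>1 \<le> r\<close> by auto
  then have "H_ge q r A B A B + H_ge q (Suc r) A B A B =
     (\<Sum>u\<in>?W. \<Sum>v\<in>?W. if Suc r \<le> cross 0 u v then ?w u v else 0) +
     (\<Sum>u\<in>?W. \<Sum>v\<in>?W. if Suc r \<le> cross 0 v u then ?w u v else 0)"
    unfolding H_ge_walks[OF n n] sum.distrib[symmetric] by simp
  then show ?thesis by (simp only: f f') simp
next
  case False
  then show ?thesis by (simp add: H_ge_as_sum paths_empty f_prod_distance qbinomial_negative)
qed

lemma H_ge_same_ends_zero:
  assumes "distance A B < int r" and "1 \<le> r"
  shows "H_ge q r A B A B = 0"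
proof -
  have "\<chi> (Path A u) (Path A v) < r" if "Path A u \<in> paths A B" for u v
  proof -
    have "cross 0 u v \<le> length u"
      using changes_le[of "gap 0 u v" "min (length u) (length v)"] by (simp add: cross_def)
    then have "\<chi> (Path A u) (Path A v) \<le> length u"
      using cross_common_start[of A u v] by auto
    then show ?thesis using that assms by (simp add: mem_paths_iff)
  qed
  moreover have "P = Path A (steps P)" if "P \<in> paths A B" for P
    using that by (metis mem_paths_iff path.exhaust_sel)
  ultimately have "\<not> r \<le> \<chi> P Q" if "P \<in> paths A B" "Q \<in> paths A B" for P Q
    using that by (metis not_le)
  then show ?thesis unfolding H_ge_as_sum by (simp add: sum.neutral)
qed

lemma H_ge_same_ends_partial:
  assumes "generic q" and "1 \<le> r"
  shows "H_ge q r A B A B = 2 * (\<Sum>j = 1..M. (- 1) ^ (j - 1) * f_prod q (r + j) A A B B)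
           + (- 1) ^ M * H_ge q (r + M) A B A B"
proof (induction M)
  case (Suc M)
  have "H_ge q (r + M) A B A B = 2 * f_prod q (r + Suc M) A A B B - H_ge q (r + Suc M) A B A B"
    using H_ge_same_ends_add[OF assms(1), of "r + M" A B] assms(2) by (simp add: algebra_simps)
  from Suc[unfolded this] show ?case by (simp add: algebra_simps)
qed simp

text \<open>Eventually both the numbers of crossings and the products run out, so the remainder vanishes.\<close>

lemma H_ge_same_ends:
  assumes "generic q" and "1 \<le> r"
  shows "H_ge q r A B A B = 2 * (\<Sum>j | 1 \<le> j \<and> f_prod q (r + j) A A B B \<noteq> 0.
                            (- 1) ^ (j - 1) * f_prod q (r + j) A A B B)"
proof -
  let ?J = "{j. 1 \<le> j \<and> f_prod q (r + j) A A B B \<noteq> 0}"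
  obtain M0 where M0: "\<forall>j\<in>?J. j < M0"
    using finite_f_prod_support[of q r A B] unfolding finite_nat_set_iff_bounded by blast
  define M where "M = max M0 (nat (distance A B))"
  have "H_ge q (r + M) A B A B = 0"
    using assms(2) by (intro H_ge_same_ends_zero) (auto simp: M_def)
  then have "H_ge q r A B A B = 2 * (\<Sum>j = 1..M. (- 1) ^ (j - 1) * f_prod q (r + j) A A B B)"
    using H_ge_same_ends_partial[OF assms, of A B M] by simp
  also have "(\<Sum>j = 1..M. (- 1) ^ (j - 1) * f_prod q (r + j) A A B B) =
      (\<Sum>j\<in>?J. (- 1) ^ (j - 1) * f_prod q (r + j) A A B B)"
    using M0 by (intro sum.mono_neutral_right) (auto simp: M_def less_imp_le le_max_iff_disj)
  finally show ?thesis .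
qed

text \<open>Evaluation at \<open>0\<close> separates positive powers of the indeterminate from \<open>1\<close>.\<close>

lemma generic_indet: "generic indet"
proof -
  have pow: "indet ^ n = Fract ([:0, 1:] ^ n) 1" for n
    by (induction n) (simp_all add: indet_def One_fract_def)
  have "indet ^ n \<noteq> 1" if "0 < n" for n
  proof
    assume "indet ^ n = 1"
    then have "([:0, 1:] :: int poly) ^ n = 1"
      unfolding pow One_fract_def by (simp add: eq_fract)
    then have "poly ([:0, 1:] ^ n) (0 :: int) = poly 1 0" by simp
    then show False using that by (simp add: poly_power zero_power)
  qed
  moreover have "indet \<noteq> 0"
    by (simp add: indet_def Zero_fract_def eq_fract)
  ultimately show ?thesis by (simp add: generic_def)
qed

theorem theorem2p4:
  fixes A1 A2 B1 B2 A B :: point and q :: "int poly fract"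
  assumes "q = indet"
    and "A1 \<prec> A2" and "B1 \<prec> B2"
    and "fst A1 + snd A1 = fst A2 + snd A2"
  shows "(\<forall>m. H_ge q (2 * m + 1) A1 B2 A2 B1 = H_ge q (2 * m) A1 B2 A2 B1 \<and>
              H_ge q (2 * m) A1 B2 A2 B1 = f_prod q (2 * m) A1 A2 B2 B1) \<and>
         (\<forall>m\<ge>1. H_ge q (2 * m) A1 B1 A2 B2 = H_ge q (2 * m - 1) A1 B1 A2 B2 \<and>
                H_ge q (2 * m - 1) A1 B1 A2 B2 = f_prod q (2 * m - 1) A1 A2 B2 B1) \<and>
         (\<forall>r. H_ge q r A B1 A B2 = f_prod q r A A B2 B1) \<and>
         (\<forall>r. H_ge q r A1 B A2 B = f_prod q r A1 A2 B B) \<and>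
         (\<forall>r. H_ge q r A B A B =
               (if r = 0 then f_prod q 0 A A B B
                else 2 * (\<Sum>j | 1 \<le> j \<and> f_prod q (r + j) A A B B \<noteq> 0.
                            (- 1) ^ (j - 1) * f_prod q (r + j) A A B B)))"
proof -
  have g: "generic q" using assms(1) generic_indet by simp
  have "H_ge q r A B A B = (if r = 0 then f_prod q 0 A A B B
                else 2 * (\<Sum>j | 1 \<le> j \<and> f_prod q (r + j) A A B B \<noteq> 0.
                            (- 1) ^ (j - 1) * f_prod q (r + j) A A B B))" for r
    using H_ge_same_ends_0[OF g] H_ge_same_ends[OF g, of r A B] by simp
  then show ?thesis
    using H_ge_endpoints_SE_NW[OF g assms(2-4)] H_ge_endpoints_NW_SE[OF g assms(2-4)]
      H_ge_common_start[OF g assms(3)] H_ge_common_end[OF g assms(2,4)]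
    by blast
qed

end
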